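(* Let $t\ge 4$ be an integer and let $G=(V,E_G)$ be a graph. The following statements are equivalent: (i) $G$ is a half-square of a bipartite graph with girth at least $2t$, i.e., there is a bipartite graph $B=(V,W,E_B)$ of girth at least $2t$ with $G=B^2[V]$; (ii) $G$ is diamond-free and $C_\ell$-free for every $4\le \ell\le t-1$; (iii) the vertex-clique incidence bipartite graph $B_G$ of $G$ has girth at least $2t$.
   Context: All graphs are finite, simple and connected. For a graph $H$, the square $H^2$ is obtained from $H$ by adding an edge between every two distinct vertices at distance two in $H$. For a bipartite graph $B=(X,Y,E_B)$ with color classes $X,Y$, the half-square $B^2[X]$ is the subgraph of $B^2$ induced by $X$; equivalently, two vertices of $X$ are adjacent iff they have a common neighbor in $Y$. The girth of a graph is the length of a shortest cycle (the girth of a tree is $\infty$). The diamond is $K_4$ minus an edge; $C_\ell$ is the cycle on $\ell$ vertices; a graph is $F$-free if it has no induced subgraph isomorphic to $F$. The vertex-clique incidence bipartite graph of $G$ is $B_G=(V,\mathcal{C}(G),E_B)$, where $\mathcal{C}(G)$ is the set of maximal cliques of $G$ and $vQ\in E_B$ iff $v\in Q$. *)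

theory Defs
  imports
    "Graph_Theory.Pair_Digraph"
    "Graph_Theory.Digraph_Component"
    "Graph_Theory.Digraph_Isomorphism"
    "Graph_Theory.Shortest_Path"
    "HOL-Library.Extended_Nat"
begin

text \<open>
  A finite simple graph is a \<^locale>\<open>pair_graph\<close>, in which an undirected edge is represented by
  the two arcs between its ends. The coercion \<^const>\<open>with_proj\<close> turns it into a
  \<^typ>\<open>('a, 'a \<times> 'a) pre_digraph\<close>.
\<close>

subsection \<open>Girth, square and half-square\<close>

text \<open>
  In a symmetric digraph, running along an edge and back again is a directed cycle of length 2.
  Hence only directed cycles of length at least 3 represent cycles of the undirected graph.
  For an acyclic graph the infimum is \<open>\<infinity>\<close>.
\<close>

definition girth :: "'a pair_pre_digraph \<Rightarrow> enat" where
  "girth G = (INF p \<in> {p. pre_digraph.cycle G p \<and> 3 \<le> length p}. enat (length p))"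

definition graph_dist :: "'a pair_pre_digraph \<Rightarrow> 'a \<Rightarrow> 'a \<Rightarrow> ereal" where
  "graph_dist G u v = wf_digraph.\<mu> G (\<lambda>_. 1) u v"

definition square :: "'a pair_pre_digraph \<Rightarrow> 'a pair_pre_digraph" where
  "square H = \<lparr> pverts = pverts H,
     parcs = parcs H \<union> {(u, v). u \<in> pverts H \<and> v \<in> pverts H \<and> u \<noteq> v \<and> graph_dist H u v = 2} \<rparr>"

definition bipartite_graph :: "'a set \<Rightarrow> 'a set \<Rightarrow> 'a pair_pre_digraph \<Rightarrow> bool" where
  "bipartite_graph X Y B \<longleftrightarrow> pair_graph B \<and> pverts B = X \<union> Y \<and> X \<inter> Y = {} \<and>
     parcs B \<subseteq> X \<times> Y \<union> Y \<times> X"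

definition half_square :: "'a pair_pre_digraph \<Rightarrow> 'a set \<Rightarrow> ('a, 'a \<times> 'a) pre_digraph" where
  "half_square B X = square B \<restriction> X"

definition rename_graph :: "('a \<Rightarrow> 'b) \<Rightarrow> 'a pair_pre_digraph \<Rightarrow> 'b pair_pre_digraph" where
  "rename_graph f G = \<lparr> pverts = f ` pverts G, parcs = map_prod f f ` parcs G \<rparr>"

text \<open>
  The color classes \<open>V\<close> and \<open>W\<close> of the bipartite graph are made disjoint by tagging them with
  \<^const>\<open>Inl\<close> and \<^const>\<open>Inr\<close>. As graphs are finite, taking \<open>W\<close> to be a (finite) set of natural
  numbers is no restriction. Like all graphs considered, \<open>B\<close> is connected.
\<close>

definition half_square_of_girth_ge :: "nat \<Rightarrow> 'a pair_pre_digraph \<Rightarrow> bool" where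
  "half_square_of_girth_ge k G \<longleftrightarrow>
     (\<exists>(W :: nat set) (B :: ('a + nat) pair_pre_digraph).
        bipartite_graph (Inl ` pverts G) (Inr ` W) B \<and> connected B \<and> enat k \<le> girth B \<and>
        with_proj (rename_graph Inl G) = half_square B (Inl ` pverts G))"

subsection \<open>Forbidden induced subgraphs\<close>

definition free_of :: "'b pair_pre_digraph \<Rightarrow> 'a pair_pre_digraph \<Rightarrow> bool" where
  "free_of F G \<longleftrightarrow> \<not> (\<exists>H :: ('a, 'a \<times> 'a) pre_digraph. induced_subgraph H G \<and> digraph_iso H F)"

definition diamond :: "nat pair_pre_digraph" where
  "diamond = \<lparr> pverts = {0..<4},
     parcs = {(i, j). i < 4 \<and> j < 4 \<and> i \<noteq> j \<and> {i, j} \<noteq> {0, 1}} \<rparr>"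

definition cycle_graph :: "nat \<Rightarrow> nat pair_pre_digraph" where
  "cycle_graph l = \<lparr> pverts = {0..<l},
     parcs = {(i, j). i < l \<and> j < l \<and> (j = (i + 1) mod l \<or> i = (j + 1) mod l)} \<rparr>"

subsection \<open>The vertex-clique incidence bipartite graph\<close>

definition clique :: "'a pair_pre_digraph \<Rightarrow> 'a set \<Rightarrow> bool" where
  "clique G Q \<longleftrightarrow> Q \<subseteq> pverts G \<and> (\<forall>u \<in> Q. \<forall>v \<in> Q. u \<noteq> v \<longrightarrow> (u, v) \<in> parcs G)"

definition maximal_cliques :: "'a pair_pre_digraph \<Rightarrow> 'a set set" where
  "maximal_cliques G = {Q. clique G Q \<and> (\<forall>Q'. clique G Q' \<and> Q \<subseteq> Q' \<longrightarrow> Q' = Q)}"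

definition vertex_clique_graph :: "'a pair_pre_digraph \<Rightarrow> ('a + 'a set) pair_pre_digraph" where
  "vertex_clique_graph G = \<lparr> pverts = Inl ` pverts G \<union> Inr ` maximal_cliques G,
     parcs = (\<Union>Q \<in> maximal_cliques G. \<Union>v \<in> Q. {(Inl v, Inr Q), (Inr Q, Inl v)}) \<rparr>"

end

theory Submission
  imports Defs
begin

text \<open>
  A bipartite graph with classes \<open>V\<close>, \<open>W\<close> is an incidence relation between \<open>V\<close> and \<open>W\<close>, and its
  cycles of length \<open>2 l\<close> are the cyclic sequences of \<open>l\<close> distinct vertices and \<open>l\<close> distinct elements
  of \<open>W\<close> in which consecutive ones are incident.

  If \<open>G\<close> is the half-square of a bipartite graph of girth at least \<open>2 t \<ge> 8\<close>, then the vertices of any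
  triangle of \<open>G\<close> have a common neighbour in \<open>W\<close> (otherwise there is a 6-cycle), so the two triangles
  of a diamond would yield a 4-cycle, and an induced \<open>C\<^sub>l\<close> lifts to a cycle of length \<open>2 l\<close>.
  Conversely, in a diamond-free graph without induced \<open>C\<^sub>l\<close> for \<open>4 \<le> l < t\<close>, every cycle of length
  less than \<open>t\<close> spans a clique, and two maximal cliques sharing two vertices coincide; hence all cliques
  along a short cycle of the vertex-clique graph would be equal. Finally, \<open>G\<close> is always the half-square
  of its vertex-clique graph.
\<close>

section \<open>Induced subgraphs as embeddings of vertices\<close>

text \<open>\<open>digraph_iso\<close> carries separate maps for vertices and arcs. Both graphs have
  \<open>fst\<close> and \<open>snd\<close> as tail and head, so the vertex map forces the arc map,
  and only an injection that preserves and reflects adjacency remains.\<close>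

lemma free_of_iff_no_embedding:
  fixes F :: "'b pair_pre_digraph" and G :: "'a pair_pre_digraph"
  assumes F: "pair_wf_digraph F" and G: "pair_wf_digraph G"
  shows "free_of F G \<longleftrightarrow> \<not> (\<exists>f. inj_on f (pverts F) \<and> f ` pverts F \<subseteq> pverts G \<and>
    (\<forall>i\<in>pverts F. \<forall>j\<in>pverts F. (f i, f j) \<in> parcs G \<longleftrightarrow> (i, j) \<in> parcs F))"
proof -
  have "\<exists>H :: ('a, 'a \<times> 'a) pre_digraph. induced_subgraph H G \<and> digraph_iso H F"
    if f: "inj_on f (pverts F)" "f ` pverts F \<subseteq> pverts G"
      "\<forall>i\<in>pverts F. \<forall>j\<in>pverts F. (f i, f j) \<in> parcs G \<longleftrightarrow> (i, j) \<in> parcs F" for f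
  proof (intro exI conjI)
    let ?H = "with_proj G \<restriction> (f ` pverts F)"
    let ?g = "inv_into (pverts F) f"
    let ?h = "\<lparr>iso_verts = ?g, iso_arcs = map_prod ?g ?g, iso_head = snd, iso_tail = fst\<rparr>"
    have wG: "wf_digraph (with_proj G)" using G by (simp add: wf_digraph_wp_iff)
    show ind: "induced_subgraph ?H G"
      using wf_digraph.induced_induce[OF wG, of "f ` pverts F"] f(2) by simp
    have wH: "wf_digraph ?H"
      using ind by (simp add: induced_subgraph_def subgraph_def)
    have arcsF: "i \<in> pverts F \<and> j \<in> pverts F" if "(i, j) \<in> parcs F" for i j
      using that F by (auto dest: pair_wf_digraph.in_arcsD1 pair_wf_digraph.in_arcsD2)
    have gf: "?g (f i) = i" if "i \<in> pverts F" for i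
      using that f(1) by simp
    have arcsH: "arcs ?H = map_prod f f ` parcs F"
      using f(3) arcsF by (fastforce simp: induce_subgraph_def)
    have gfa: "map_prod ?g ?g (map_prod f f e) = e" if "e \<in> parcs F" for e
      using arcsF[of "fst e" "snd e"] gf that by (cases e) simp
    have inj: "inj_on ?g (f ` pverts F)" by (simp add: inj_on_inv_into)
    have inj': "inj_on (map_prod ?g ?g) (arcs ?H)"
      unfolding arcsH by (rule inj_on_inverseI[where g = "map_prod f f"]) (erule imageE, simp only: gfa)
    have img: "map_prod ?g ?g ` arcs ?H = parcs F"
      unfolding arcsH image_image by (simp only: gfa image_ident cong: image_cong)
    have img': "?g ` f ` pverts F = pverts F" using gf by (simp add: image_image)
    have H: "verts ?H = f ` pverts F" "tail ?H = fst" "head ?H = snd"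
      by (simp_all add: induce_subgraph_def)
    have "pre_digraph.digraph_isomorphism ?H ?h"
      using wH inj inj' unfolding pre_digraph.digraph_isomorphism_def H by simp
    moreover have "with_proj F = app_iso ?h ?H"
      by (simp only: app_iso_def H digraph_isomorphism.simps img img' with_proj_def[of F])
    ultimately show "digraph_iso ?H F" unfolding digraph_iso_def by (intro exI conjI)
  qed
  moreover have "\<exists>f. inj_on f (pverts F) \<and> f ` pverts F \<subseteq> pverts G \<and>
    (\<forall>i\<in>pverts F. \<forall>j\<in>pverts F. (f i, f j) \<in> parcs G \<longleftrightarrow> (i, j) \<in> parcs F)"
    if ind: "induced_subgraph H G" and iso: "digraph_iso H F" for H :: "('a, 'a \<times> 'a) pre_digraph"
  proof -
    obtain h where h: "pre_digraph.digraph_isomorphism H h" and F_eq: "with_proj F = app_iso h H"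
      using iso by (auto simp: digraph_iso_def)
    let ?f = "inv_into (verts H) (iso_verts h)"
    have proj: "tail H = fst" "head H = snd" "verts H \<subseteq> pverts G"
      and arcsH: "arcs H = {e \<in> parcs G. fst e \<in> verts H \<and> snd e \<in> verts H}"
      using ind by (auto simp: induced_subgraph_def subgraph_def compatible_def)
    \<comment> \<open>Comparing the ends in \<open>with_proj F\<close> with those in
      \<open>app_iso h H\<close> identifies the end maps of \<open>h\<close>; this ties
      \<open>iso_arcs h\<close> to \<open>iso_verts h\<close>.\<close>
    have "iso_tail h = fst" "iso_head h = snd"
      using F_eq by (simp_all add: app_iso_def with_proj_def)
    then have ends: "iso_arcs h (u, v) = (iso_verts h u, iso_verts h v)" if "(u, v) \<in> arcs H" for u v
      using h that unfolding pre_digraph.digraph_isomorphism_def proj(1,2) 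
      by (metis fst_conv snd_conv prod.collapse)
    have inj: "inj_on (iso_verts h) (verts H)"
      using h by (simp add: pre_digraph.digraph_isomorphism_def)
    have vF: "pverts F = iso_verts h ` verts H" and aF: "parcs F = iso_arcs h ` arcs H"
      using F_eq by (simp_all add: app_iso_def with_proj_def)
    have fv: "?f i \<in> verts H" "iso_verts h (?f i) = i" if "i \<in> pverts F" for i
      using that vF by (simp_all add: inv_into_into f_inv_into_f)
    have "(?f i, ?f j) \<in> parcs G \<longleftrightarrow> (i, j) \<in> parcs F" if ij: "i \<in> pverts F" "j \<in> pverts F" for i j
    proof
      assume "(?f i, ?f j) \<in> parcs G"
      then have "(?f i, ?f j) \<in> arcs H" using arcsH fv ij by simp
      then show "(i, j) \<in> parcs F" using ends[of "?f i" "?f j"] aF fv ij by force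
    next
      assume "(i, j) \<in> parcs F"
      then obtain u v where uv: "(u, v) \<in> arcs H" "iso_arcs h (u, v) = (i, j)"
        using aF by auto
      then have "u \<in> verts H" "v \<in> verts H" using arcsH by auto
      then have "?f i = u" "?f j = v" using ends[OF uv(1)] uv(2) inj by auto
      then show "(?f i, ?f j) \<in> parcs G" using uv(1) arcsH by auto
    qed
    moreover have "inj_on ?f (pverts F)" using vF by (simp add: inj_on_inv_into)
    moreover have "?f ` pverts F \<subseteq> pverts G" using fv proj(3) by blast
    ultimately show ?thesis by blast
  qed
  ultimately show ?thesis unfolding free_of_def by blast
qed

section \<open>Girth through cyclic vertex lists\<close>

text \<open>Prepending \<open>last xs\<close> encodes the step from the last entry back to the
  first. In a symmetric relation any edge gives a closed chain of length two, so length and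
  distinctness are imposed separately.\<close>

definition closed_chain :: "('a \<Rightarrow> 'a \<Rightarrow> bool) \<Rightarrow> 'a list \<Rightarrow> bool" where
  "closed_chain R xs \<longleftrightarrow> xs \<noteq> [] \<and> successively R (last xs # xs)"

lemma closed_chain_rotate1: "closed_chain R (rotate1 xs) \<longleftrightarrow> closed_chain R xs"
  by (cases xs) (auto simp: closed_chain_def successively_append_iff successively_Cons)

lemma closed_chain_rotate: "closed_chain R (rotate n xs) \<longleftrightarrow> closed_chain R xs"
  by (induction n) (simp_all add: closed_chain_rotate1)

lemma closed_chain_conv_nth:
  "closed_chain R xs \<longleftrightarrow> xs \<noteq> [] \<and> (\<forall>i<length xs. R (xs ! i) (xs ! (Suc i mod length xs)))"
proof (cases "xs = []")
  case False
  \<comment> \<open>After one rotation the closing step stands at the end, so the list to be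
    traversed is \<open>xs @ [hd xs]\<close>, whose entry \<open>Suc i\<close> is an entry of
    \<open>xs\<close> with index taken modulo the length.\<close>
  have "closed_chain R xs \<longleftrightarrow> closed_chain R (rotate1 xs)" by (simp add: closed_chain_rotate1)
  also have "\<dots> \<longleftrightarrow> successively R (xs @ [hd xs])"
    using False by (cases xs) (simp_all add: closed_chain_def)
  also have "\<dots> \<longleftrightarrow>
      (\<forall>i<length xs. R ((xs @ [hd xs]) ! i) ((xs @ [hd xs]) ! Suc i))"
    by (simp add: successively_conv_nth)
  also have "\<dots> \<longleftrightarrow> (\<forall>i<length xs. R (xs ! i) (xs ! (Suc i mod length xs)))"
  proof -
    have "(xs @ [hd xs]) ! Suc i = xs ! (Suc i mod length xs)" if "i < length xs" for i
      using that False by (auto simp: nth_append hd_conv_nth less_Suc_eq mod_Suc)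
    then show ?thesis by (simp add: nth_append)
  qed
  finally show ?thesis using False by simp
qed (simp add: closed_chain_def)

text \<open>A directed cycle is a list of arcs. The heads of these arcs form a closed chain of the
  same length, and the arcs can be restored from that chain.\<close>

lemma le_girth_iff:
  assumes "pair_wf_digraph G"
  shows "enat k \<le> girth G \<longleftrightarrow> (\<forall>xs. closed_chain (\<lambda>u v. (u, v) \<in> parcs G) xs \<and> distinct xs \<and>
    3 \<le> length xs \<longrightarrow> k \<le> length xs)"
proof -
  interpret pair_wf_digraph G by fact
  let ?E = "\<lambda>u v. (u, v) \<in> parcs G"
  have verts: "pawalk_verts u p = u # map snd p" if "pcas u p v" for u p v
    using that by (induction p arbitrary: u) auto
  \<comment> \<open>A walk from \<open>u\<close> is determined by \<open>u\<close> and the heads of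
    its arcs: each tail is the preceding head.\<close>
  have walk: "set p \<subseteq> parcs G \<and> pcas u p v \<longleftrightarrow>
      p = zip (u # map snd p) (map snd p) \<and> successively ?E (u # map snd p) \<and> last (u # map snd p) = v"
    for u p v
    by (induction p arbitrary: u) (force simp: successively_Cons prod_eq_iff)+
  have cyc: "cycle p \<longleftrightarrow> (\<exists>u. u \<in> pverts G \<and> (set p \<subseteq> parcs G \<and> pcas u p u) \<and>
      distinct (tl (pawalk_verts u p)) \<and> p \<noteq> [])" for p
    by (auto simp: cycle_def awalk_def awalk_verts_with_proj_eq cas_with_proj_eq)
  have A: "\<exists>xs. closed_chain ?E xs \<and> distinct xs \<and> length xs = length p" if p: "cycle p" for p
  proof -
    obtain u where u: "set p \<subseteq> parcs G \<and> pcas u p u" "distinct (tl (pawalk_verts u p))" "p \<noteq> []"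
      using p unfolding cyc by blast
    have "closed_chain ?E (map snd p)"
      using u(1,3) unfolding walk closed_chain_def by simp
    moreover have "distinct (map snd p)" using u verts by fastforce
    ultimately show ?thesis by (intro exI[of _ "map snd p"]) simp
  qed
  \<comment> \<open>Each entry is paired with its cyclic predecessor. The walk starts and ends at
    \<open>last xs\<close>, and \<open>zip\<close> drops the surplus final entry of
    \<open>last xs # xs\<close>.\<close>
  have B: "cycle (zip (last xs # xs) xs)" if xs: "closed_chain ?E xs" "distinct xs" for xs
  proof -
    let ?p = "zip (last xs # xs) xs"
    have snd: "map snd ?p = xs" by (simp add: map_snd_zip_take)
    have p: "set ?p \<subseteq> parcs G \<and> pcas (last xs) ?p (last xs)"
      unfolding walk snd using xs(1) by (simp add: closed_chain_def)
    moreover have "last xs \<in> pverts G"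
      using xs(1) by (cases xs) (auto simp: closed_chain_def dest: in_arcsD1)
    moreover have "?p \<noteq> []" using xs(1) by (cases xs) (auto simp: closed_chain_def)
    moreover have "distinct (tl (pawalk_verts (last xs) ?p))"
      using verts[of "last xs" ?p "last xs"] p snd xs(2) by simp
    ultimately show ?thesis unfolding cyc by blast
  qed
  have "k \<le> length p" if "cycle p" "3 \<le> length p"
    "\<forall>xs. closed_chain ?E xs \<and> distinct xs \<and> 3 \<le> length xs \<longrightarrow> k \<le> length xs" for p
    using A[OF that(1)] that(2,3) by auto
  moreover have "k \<le> length xs" if "\<forall>p. cycle p \<and> 3 \<le> length p \<longrightarrow> k \<le> length p"
    "closed_chain ?E xs" "distinct xs" "3 \<le> length xs" for xs
    using that(1)[rule_format, of "zip (last xs # xs) xs"] B[OF that(2,3)] that(4) by simp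
  ultimately show ?thesis unfolding girth_def le_INF_iff by auto
qed

section \<open>Bipartite graphs as incidence relations, and their cycles\<close>

text \<open>A common form for the bipartite graph behind a half-square and for
  \<open>vertex_clique_graph\<close>; the sum type keeps the classes disjoint.\<close>

definition incidence_graph :: "'a set \<Rightarrow> 'b set \<Rightarrow> ('a \<times> 'b) set \<Rightarrow> ('a + 'b) pair_pre_digraph" where
  "incidence_graph V W I = \<lparr> pverts = Inl ` V \<union> Inr ` W,
     parcs = (\<Union>(a, b) \<in> I. {(Inl a, Inr b), (Inr b, Inl a)}) \<rparr>"

lemma pverts_incidence_graph [simp]: "pverts (incidence_graph V W I) = Inl ` V \<union> Inr ` W"
  by (simp add: incidence_graph_def)

lemma parcs_incidence_graph [simp]:
  "(Inl a, Inr b) \<in> parcs (incidence_graph V W I) \<longleftrightarrow> (a, b) \<in> I"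
  "(Inr b, Inl a) \<in> parcs (incidence_graph V W I) \<longleftrightarrow> (a, b) \<in> I"
  "(Inl a, Inl a') \<notin> parcs (incidence_graph V W I)"
  "(Inr b, Inr b') \<notin> parcs (incidence_graph V W I)"
  by (auto simp: incidence_graph_def)

lemma parcs_incidence_graph_cases:
  "(x, y) \<in> parcs (incidence_graph V W I) \<longleftrightarrow>
    (\<exists>a b. (a, b) \<in> I \<and> (x = Inl a \<and> y = Inr b \<or> x = Inr b \<and> y = Inl a))"
  by (auto simp: incidence_graph_def)

lemma parcs_incidence_graph_subset:
  assumes "I \<subseteq> V \<times> W"
  shows "parcs (incidence_graph V W I) \<subseteq> Inl ` V \<times> Inr ` W \<union> Inr ` W \<times> Inl ` V"
proof (rule subrelI)
  fix x y assume "(x, y) \<in> parcs (incidence_graph V W I)"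
  then obtain a b where "(a, b) \<in> I" "x = Inl a \<and> y = Inr b \<or> x = Inr b \<and> y = Inl a"
    unfolding parcs_incidence_graph_cases by blast
  moreover from this(1) have "a \<in> V" "b \<in> W" using assms by auto
  ultimately show "(x, y) \<in> Inl ` V \<times> Inr ` W \<union> Inr ` W \<times> Inl ` V" by auto
qed

lemma pair_wf_digraph_incidence_graph:
  assumes "I \<subseteq> V \<times> W"
  shows "pair_wf_digraph (incidence_graph V W I)"
proof
  fix e assume "e \<in> parcs (incidence_graph V W I)"
  then have "e \<in> Inl ` V \<times> Inr ` W \<union> Inr ` W \<times> Inl ` V"
    using parcs_incidence_graph_subset[OF assms] by blast
  then show "fst e \<in> pverts (incidence_graph V W I)" "snd e \<in> pverts (incidence_graph V W I)"
    by auto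
qed

lemma pair_graph_incidence_graph:
  assumes "I \<subseteq> V \<times> W" "finite V" "finite W"
  shows "pair_graph (incidence_graph V W I)"
proof -
  interpret pair_wf_digraph "incidence_graph V W I"
    using assms(1) by (rule pair_wf_digraph_incidence_graph)
  show ?thesis
  proof
    show "finite (pverts (incidence_graph V W I))" using assms by simp
    have "finite I" using assms by (meson finite_SigmaI finite_subset)
    then show "finite (parcs (incidence_graph V W I))"
      by (auto simp: incidence_graph_def)
    show "symmetric (incidence_graph V W I)"
      by (auto simp: symmetric_def sym_def parcs_incidence_graph_cases)
    show "fst e \<noteq> snd e" if "e \<in> parcs (incidence_graph V W I)" for e
      using that by (cases e) (auto simp: parcs_incidence_graph_cases)
  qed
qed

lemma bipartite_graph_incidence_graph:
  assumes "I \<subseteq> V \<times> W" "finite V" "finite W"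
  shows "bipartite_graph (Inl ` V) (Inr ` W) (incidence_graph V W I)"
  using pair_graph_incidence_graph[OF assms] parcs_incidence_graph_subset[OF assms(1)]
  by (auto simp: bipartite_graph_def)

lemma bipartite_graph_eq_incidence_graph:
  assumes "bipartite_graph (Inl ` V) (Inr ` W) B"
  obtains I where "I \<subseteq> V \<times> W" "B = incidence_graph V W I"
proof
  have B: "pair_graph B" "pverts B = Inl ` V \<union> Inr ` W"
    "parcs B \<subseteq> Inl ` V \<times> Inr ` W \<union> Inr ` W \<times> Inl ` V"
    using assms by (auto simp: bipartite_graph_def)
  interpret pair_graph B by fact
  let ?I = "{(a, b). (Inl a, Inr b) \<in> parcs B}"
  show "?I \<subseteq> V \<times> W" using B(3) by auto
  have arcs: "(x, y) \<in> parcs B \<longleftrightarrow> (x, y) \<in> parcs (incidence_graph V W ?I)" for x y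
    using B(3) arcs_symmetric by (auto simp: parcs_incidence_graph_cases)
  show "B = incidence_graph V W ?I"
  proof (rule pair_pre_digraph.equality)
    show "parcs B = parcs (incidence_graph V W ?I)"
      by (intro equalityI subrelI) (erule iffD1[OF arcs], erule iffD2[OF arcs])
  qed (simp_all add: B(2))
qed

text \<open>A pair \<open>(a, b)\<close> stands for the vertex \<open>a\<close> followed by the vertex \<open>b\<close> of the other class, so
  that the list represents a cycle of twice its length.\<close>

definition incidence_cycle :: "('a \<times> 'b) set \<Rightarrow> ('a \<times> 'b) list \<Rightarrow> bool" where
  "incidence_cycle I ps \<longleftrightarrow> closed_chain (\<lambda>(a, b) (a', b'). (a', b) \<in> I \<and> (a', b') \<in> I) ps \<and>
     distinct (map fst ps) \<and> distinct (map snd ps) \<and> 2 \<le> length ps"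

lemma incidence_cycle_nth:
  assumes "incidence_cycle I ps" "i < length ps"
  shows "ps ! i \<in> I" "(fst (ps ! (Suc i mod length ps)), snd (ps ! i)) \<in> I"
proof -
  have "(fst (ps ! (Suc j mod length ps)), snd (ps ! j)) \<in> I \<and> ps ! (Suc j mod length ps) \<in> I"
    if "j < length ps" for j
    using assms(1) that by (auto simp: incidence_cycle_def closed_chain_conv_nth split_beta)
  \<comment> \<open>The chain condition asserts incidence of the second pair of each step, so the
    incidence of pair \<open>i\<close> comes from its cyclic predecessor \<open>j\<close>.\<close>
  moreover obtain j where "j < length ps" "Suc j mod length ps = i"
    using assms(2) that[of "length ps - 1"] that[of "i - 1"] by (cases i) auto
  ultimately show "ps ! i \<in> I" "(fst (ps ! (Suc i mod length ps)), snd (ps ! i)) \<in> I"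
    using assms(2) by auto
qed

lemma incidence_cycleI:
  assumes "\<And>i. i < length ps \<Longrightarrow> ps ! i \<in> I"
    and "\<And>i. i < length ps \<Longrightarrow> (fst (ps ! (Suc i mod length ps)), snd (ps ! i)) \<in> I"
    and "distinct (map fst ps)" "distinct (map snd ps)" "2 \<le> length ps"
  shows "incidence_cycle I ps"
proof -
  have "ps \<noteq> []" using assms(5) by (cases ps) auto
  moreover from this have "Suc i mod length ps < length ps" for i by simp
  ultimately show ?thesis
    using assms by (auto simp: incidence_cycle_def closed_chain_conv_nth split_beta)
qed

abbreviation interleave :: "('a \<times> 'b) list \<Rightarrow> ('a + 'b) list" where
  "interleave ps \<equiv> concat (map (\<lambda>(a, b). [Inl a, Inr b]) ps)"

lemma interleave_eq_Nil_iff: "interleave ps = [] \<longleftrightarrow> ps = []"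
  by (cases ps) auto

lemma length_interleave: "length (interleave ps) = 2 * length ps"
  by (induction ps) auto

lemma set_interleave:
  "Inl a \<in> set (interleave ps) \<longleftrightarrow> a \<in> fst ` set ps"
  "Inr b \<in> set (interleave ps) \<longleftrightarrow> b \<in> snd ` set ps"
  by force+

lemma distinct_interleave:
  "distinct (interleave ps) \<longleftrightarrow> distinct (map fst ps) \<and> distinct (map snd ps)"
proof (induction ps)
  case (Cons p ps)
  then show ?case by (cases p) (auto simp: set_interleave simp del: set_concat)
qed simp

lemma last_interleave: "ps \<noteq> [] \<Longrightarrow> last (interleave ps) = Inr (snd (last ps))"
  by (induction ps rule: rev_induct) (auto simp: split_beta)

lemma closed_chain_interleave:
  "closed_chain (\<lambda>u v. (u, v) \<in> parcs (incidence_graph V W I)) (interleave ps) \<longleftrightarrow>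
   closed_chain (\<lambda>(a, b) (a', b'). (a', b) \<in> I \<and> (a', b') \<in> I) ps"
proof -
  \<comment> \<open>The relation on pairs ignores the first component of its left argument, so the
    preceding \<open>Inr b\<close> carries all that matters. To close the chain,
    \<open>(a, b)\<close> becomes \<open>last ps\<close>.\<close>
  have "successively (\<lambda>u v. (u, v) \<in> parcs (incidence_graph V W I)) (Inr b # interleave ps) \<longleftrightarrow>
    successively (\<lambda>(a, b) (a', b'). (a', b) \<in> I \<and> (a', b') \<in> I) ((a, b) # ps)" for a b
    by (induction ps arbitrary: a b) (auto simp: successively_Cons)
  from this[of "snd (last ps)" "fst (last ps)"] show ?thesis
    by (cases "ps = []") (simp_all add: closed_chain_def last_interleave interleave_eq_Nil_iff
        del: successively.simps concat_eq_Nil_conv)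
qed

text \<open>Arcs alternate between the classes, so such a list breaks into blocks of two, each
  beginning on the \<open>Inl\<close> side; the condition on the last entry excludes an odd
  length.\<close>

lemma successively_imp_interleave:
  assumes "successively (\<lambda>u v. (u, v) \<in> parcs (incidence_graph V W I)) xs"
    and "xs \<noteq> [] \<Longrightarrow> hd xs \<in> range Inl \<and> last xs \<in> range Inr"
  shows "\<exists>ps. xs = interleave ps"
  using assms
proof (induction xs rule: induct_list012)
  case 1
  show ?case by (intro exI[of _ "[]"]) simp
next
  case (2 x)
  then show ?case by auto
next
  case (3 x y zs)
  obtain a where a: "x = Inl a" using 3(4) by auto
  then obtain b where ab: "x = Inl a" "y = Inr b"
    using 3(3) by (cases y) auto
  have "hd zs \<in> range Inl" if "zs \<noteq> []"
    using 3(3) that ab by (cases zs) (auto simp: parcs_incidence_graph_cases)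
  then have "\<exists>ps. zs = interleave ps"
    using 3 by (intro "3.IH"(1)) (auto simp: successively_Cons split: if_splits)
  then obtain ps where "zs = interleave ps" ..
  then show ?case using ab by (intro exI[of _ "(a, b) # ps"]) simp
qed

lemma closed_chain_imp_interleave:
  assumes xs: "closed_chain (\<lambda>u v. (u, v) \<in> parcs (incidence_graph V W I)) xs"
  shows "\<exists>n ps. rotate n xs = interleave ps"
proof -
  let ?E = "\<lambda>u v. (u, v) \<in> parcs (incidence_graph V W I)"
  have *: "\<exists>ps. ys = interleave ps" if ys: "closed_chain ?E ys" "hd ys \<in> range Inl" for ys
  proof (rule successively_imp_interleave)
    show "successively ?E ys" 
      using ys by (auto simp: closed_chain_def successively_Cons)
    show "hd ys \<in> range Inl \<and> last ys \<in> range Inr"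
      using ys by (auto simp: closed_chain_def successively_Cons parcs_incidence_graph_cases)
  qed
  show ?thesis
  proof (cases "hd xs \<in> range Inl")
    case True
    then show ?thesis using *[OF xs] by (intro exI[of _ 0]) simp
  next
    case False
    then obtain b ys where b: "xs = Inr b # ys"
      using xs by (cases xs; cases "hd xs") (auto simp: closed_chain_def)
    \<comment> \<open>A chain that starts in the second class continues in the first, so a single
      rotation suffices.\<close>
    have "hd (rotate1 xs) \<in> range Inl"
      using xs b by (cases ys) (auto simp: closed_chain_def parcs_incidence_graph_cases)
    then show ?thesis using *[of "rotate1 xs"] xs
      by (intro exI[of _ 1]) (simp add: closed_chain_rotate1)
  qed
qed

text \<open>Up to rotation every closed chain is the \<open>interleave\<close> of a list half as
  long, and rotation affects neither closedness nor distinctness. As lengths are even, at least 3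
  entries means at least 2 pairs, the bound in \<open>incidence_cycle\<close>.\<close>

lemma le_girth_incidence_graph_iff:
  assumes I: "I \<subseteq> V \<times> W"
  shows "enat (2 * k) \<le> girth (incidence_graph V W I) \<longleftrightarrow>
    (\<forall>ps. incidence_cycle I ps \<longrightarrow> k \<le> length ps)"
proof -
  note girth = le_girth_iff[OF pair_wf_digraph_incidence_graph[OF I]]
  show ?thesis
  proof
    assume k: "enat (2 * k) \<le> girth (incidence_graph V W I)"
    show "\<forall>ps. incidence_cycle I ps \<longrightarrow> k \<le> length ps"
    proof (intro allI impI)
      fix ps assume "incidence_cycle I ps"
      then have "closed_chain (\<lambda>u v. (u, v) \<in> parcs (incidence_graph V W I)) (interleave ps)"
        "distinct (interleave ps)" "3 \<le> length (interleave ps)"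
        unfolding incidence_cycle_def closed_chain_interleave distinct_interleave length_interleave
        by auto
      then have "2 * k \<le> length (interleave ps)"
        using k unfolding girth by blast
      then show "k \<le> length ps" by (simp add: length_interleave)
    qed
  next
    assume k: "\<forall>ps. incidence_cycle I ps \<longrightarrow> k \<le> length ps"
    show "enat (2 * k) \<le> girth (incidence_graph V W I)"
      unfolding girth
    proof (intro allI impI, elim conjE)
      fix xs assume xs: "closed_chain (\<lambda>u v. (u, v) \<in> parcs (incidence_graph V W I)) xs"
        "distinct xs" "3 \<le> length xs"
      obtain n ps where ps: "rotate n xs = interleave ps"
        using closed_chain_imp_interleave[OF xs(1)] by blast
      have len: "length xs = 2 * length ps"
        using arg_cong[OF ps, of length] by (simp add: length_interleave)
      have "closed_chain (\<lambda>u v. (u, v) \<in> parcs (incidence_graph V W I)) (interleave ps)"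
        unfolding ps[symmetric] closed_chain_rotate by (rule xs(1))
      moreover have "distinct (interleave ps)"
        unfolding ps[symmetric] distinct_rotate by (rule xs(2))
      ultimately have "incidence_cycle I ps"
        using xs(3) len unfolding incidence_cycle_def closed_chain_interleave distinct_interleave
        by simp
      then show "2 * k \<le> length xs" using k len by simp
    qed
  qed
qed

section \<open>Distance two, half-squares and connectedness\<close>

text \<open>With unit costs \<open>graph_dist\<close> is the infimum of the walk lengths. The
  hypotheses exclude lengths 0 and 1, and a walk of length 2 is a choice of its middle
  vertex.\<close>

lemma graph_dist_eq_2_iff:
  assumes "pair_loopfree_digraph G" "u \<noteq> v" "(u, v) \<notin> parcs G"
  shows "graph_dist G u v = 2 \<longleftrightarrow> (\<exists>w. (u, w) \<in> parcs G \<and> (w, v) \<in> parcs G)"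
proof -
  interpret pair_loopfree_digraph G by fact
  have cost: "awalk_cost (\<lambda>_. 1) p = length p" for p :: "('a \<times> 'a) list"
    unfolding awalk_cost_def by (induction p) auto
  have walk2: "awalk u [e, e'] v \<longleftrightarrow> (\<exists>w. e = (u, w) \<and> e' = (w, v) \<and> e \<in> parcs G \<and> e' \<in> parcs G)"
    for e e'
    by (cases e; cases e') (auto simp: awalk_def cas_with_proj_eq dest: in_arcsD1)
  have dist: "graph_dist G u v = (INF p \<in> {p. awalk u p v}. ereal (length p))"
    unfolding graph_dist_def \<mu>_def cost ..
  have ge: "2 \<le> length p" if "awalk u p v" for p
  proof (rule ccontr)
    assume "\<not> 2 \<le> length p"
    then have "p = [] \<or> (\<exists>e. p = [e])" by (cases p; cases "tl p") auto
    then show False using that assms(2,3) by (auto simp: awalk_def cas_with_proj_eq)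
  qed
  show ?thesis
  proof
    assume d: "graph_dist G u v = 2"
    show "\<exists>w. (u, w) \<in> parcs G \<and> (w, v) \<in> parcs G"
    proof (rule ccontr)
      assume no: "\<not> ?thesis"
      have "3 \<le> length p" if p: "awalk u p v" for p
      proof (rule ccontr)
        assume "\<not> 3 \<le> length p"
        then have "length p = 2" using ge[OF p] by simp
        then obtain e e' where "p = [e, e']" by (auto simp: numeral_2_eq_2 length_Suc_conv)
        then show False using p walk2 no by auto
      qed
      then have "(3 :: ereal) \<le> graph_dist G u v"
        unfolding dist by (auto intro!: INF_greatest)
      then show False using d by simp
    qed
  next
    assume "\<exists>w. (u, w) \<in> parcs G \<and> (w, v) \<in> parcs G"
    then obtain w where "awalk u [(u, w), (w, v)] v" using walk2 by blast
    then have "graph_dist G u v \<le> 2"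
      unfolding dist by (intro INF_lower2[of "[(u, w), (w, v)]"]) auto
    moreover have "2 \<le> graph_dist G u v"
      unfolding dist using ge by (auto intro!: INF_greatest)
    ultimately show "graph_dist G u v = 2" by simp
  qed
qed

text \<open>No arc joins two vertices of the \<open>Inl\<close> class, so inside it the square has
  only the arcs that come from distance two.\<close>

lemma half_square_incidence_graph:
  assumes "I \<subseteq> V \<times> W" "finite V" "finite W"
  shows "half_square (incidence_graph V W I) (Inl ` V) = with_proj \<lparr>pverts = Inl ` V,
    parcs = {(Inl u, Inl v) |u v. u \<noteq> v \<and> (\<exists>w. (u, w) \<in> I \<and> (v, w) \<in> I)}\<rparr>"
proof -
  interpret pair_graph "incidence_graph V W I" using assms by (rule pair_graph_incidence_graph)
  have "graph_dist (incidence_graph V W I) (Inl u) (Inl v) = 2 \<longleftrightarrow> (\<exists>w. (u, w) \<in> I \<and> (v, w) \<in> I)"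
    if "u \<noteq> v" for u v
    using graph_dist_eq_2_iff[OF pair_loopfree_digraph_axioms, of "Inl u" "Inl v"] that
    by (force simp: parcs_incidence_graph_cases)
  then have "{e \<in> parcs (square (incidence_graph V W I)). fst e \<in> Inl ` V \<and> snd e \<in> Inl ` V} =
    {(Inl u, Inl v) |u v. u \<noteq> v \<and> (\<exists>w. (u, w) \<in> I \<and> (v, w) \<in> I)}"
    using assms(1) by (auto simp: square_def)
  then show ?thesis
    by (simp add: half_square_def induce_subgraph_def with_proj_def)
qed

text \<open>\<open>connected\<close> means strong connectedness of the symmetric closure, and a
  symmetric graph is its own closure.\<close>

lemma connected_iff_rtrancl:
  assumes "pair_wf_digraph G" "symmetric G"
  shows "connected G \<longleftrightarrow> pverts G \<noteq> {} \<and> (\<forall>u\<in>pverts G. \<forall>v\<in>pverts G. (u, v) \<in> (parcs G)\<^sup>*)"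
proof -
  interpret pair_wf_digraph G by fact
  have "mk_symmetric G = G"
    using assms(2) by (cases G) (auto simp: mk_symmetric_def symmetric_def sym_def)
  moreover have "u \<rightarrow>\<^sup>*\<^bsub>with_proj G\<^esub> v \<longleftrightarrow> (u, v) \<in> (parcs G)\<^sup>*"
    if "u \<in> pverts G" "v \<in> pverts G" for u v
    using that by (simp add: reachable_conv)
  ultimately show ?thesis unfolding connected_def strongly_connected_def by auto
qed

section \<open>Diamonds, induced cycles and short closed chains\<close>

text \<open>\<open>a\<close> and \<open>b\<close> are the images of the nonadjacent vertices 0 and
  1, \<open>c\<close> and \<open>d\<close> those of 2 and 3. The remaining pairs are adjacent and
  hence distinct, as there are no loops.\<close>

lemma free_of_diamond_iff:
  assumes "pair_graph G"
  shows "free_of diamond G \<longleftrightarrow> \<not> (\<exists>a b c d. a \<noteq> b \<and> (a, b) \<notin> parcs G \<and> (c, d) \<in> parcs G \<and>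
    (a, c) \<in> parcs G \<and> (a, d) \<in> parcs G \<and> (b, c) \<in> parcs G \<and> (b, d) \<in> parcs G)"
proof -
  interpret pair_graph G by fact
  have wf: "pair_wf_digraph diamond" by standard (auto simp: diamond_def)
  have to_embedding: "\<exists>f. inj_on f (pverts diamond) \<and> f ` pverts diamond \<subseteq> pverts G \<and>
    (\<forall>i\<in>pverts diamond. \<forall>j\<in>pverts diamond. (f i, f j) \<in> parcs G \<longleftrightarrow> (i, j) \<in> parcs diamond)"
    if h: "a \<noteq> b" "(a, b) \<notin> parcs G" "(c, d) \<in> parcs G"
      "(a, c) \<in> parcs G" "(a, d) \<in> parcs G" "(b, c) \<in> parcs G" "(b, d) \<in> parcs G" for a b c d
  proof (intro exI conjI)
    let ?f = "\<lambda>i. [a, b, c, d] ! i"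
    have 4: "{0..<4} = {0, 1, 2, 3 :: nat}" by auto
    have sym: "(b, a) \<notin> parcs G" "(d, c) \<in> parcs G" "(c, a) \<in> parcs G" "(d, a) \<in> parcs G"
      "(c, b) \<in> parcs G" "(d, b) \<in> parcs G"
      using h arcs_symmetric by blast+
    have loop: "(x, x) \<notin> parcs G" for x using no_loops'[of x x] by auto
    have neq: "a \<noteq> c" "a \<noteq> d" "b \<noteq> c" "b \<noteq> d" "c \<noteq> d" using h loop by auto
    show "inj_on ?f (pverts diamond)"
      using h(1) neq by (auto simp: diamond_def 4)
    show "?f ` pverts diamond \<subseteq> pverts G"
      using h by (auto simp: diamond_def 4 dest: in_arcsD1 in_arcsD2)
    show "\<forall>i\<in>pverts diamond. \<forall>j\<in>pverts diamond. (?f i, ?f j) \<in> parcs G \<longleftrightarrow> (i, j) \<in> parcs diamond"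
      using h sym loop by (simp add: diamond_def 4 doubleton_eq_iff)
  qed
  have of_embedding: "\<exists>a b c d. a \<noteq> b \<and> (a, b) \<notin> parcs G \<and> (c, d) \<in> parcs G \<and>
    (a, c) \<in> parcs G \<and> (a, d) \<in> parcs G \<and> (b, c) \<in> parcs G \<and> (b, d) \<in> parcs G"
    if f: "inj_on f (pverts diamond)"
      "\<forall>i\<in>pverts diamond. \<forall>j\<in>pverts diamond. (f i, f j) \<in> parcs G \<longleftrightarrow> (i, j) \<in> parcs diamond" for f
  proof (intro exI conjI)
    show "f 0 \<noteq> f 1" using inj_onD[OF f(1), of 0 1] by (auto simp: diamond_def)
    show "(f 0, f 1) \<notin> parcs G" "(f 2, f 3) \<in> parcs G" "(f 0, f 2) \<in> parcs G" "(f 0, f 3) \<in> parcs G"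
      "(f 1, f 2) \<in> parcs G" "(f 1, f 3) \<in> parcs G"
      using f(2) by (simp_all add: diamond_def doubleton_eq_iff)
  qed
  show ?thesis
    unfolding free_of_iff_no_embedding[OF wf pair_wf_digraph_axioms]
    apply (intro arg_cong[where f = Not] iffI; elim exE conjE)
     apply (rule of_embedding; assumption)
    apply (rule to_embedding; assumption)
    done
qed

lemma free_of_cycle_graph_iff:
  assumes "pair_wf_digraph G"
  shows "free_of (cycle_graph l) G \<longleftrightarrow> \<not> (\<exists>xs. length xs = l \<and> distinct xs \<and> set xs \<subseteq> pverts G \<and>
    (\<forall>i<l. \<forall>j<l. (xs ! i, xs ! j) \<in> parcs G \<longleftrightarrow> j = Suc i mod l \<or> i = Suc j mod l))"
proof -
  have wf: "pair_wf_digraph (cycle_graph l)" by standard (auto simp: cycle_graph_def)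
  have *: "pverts (cycle_graph l) = {0..<l}" by (simp add: cycle_graph_def)
  have **: "(i, j) \<in> parcs (cycle_graph l) \<longleftrightarrow> j = Suc i mod l \<or> i = Suc j mod l"
    if "i < l" "j < l" for i j
    using that by (simp add: cycle_graph_def)
  have "\<exists>xs. length xs = l \<and> distinct xs \<and> set xs \<subseteq> pverts G \<and>
    (\<forall>i<l. \<forall>j<l. (xs ! i, xs ! j) \<in> parcs G \<longleftrightarrow> j = Suc i mod l \<or> i = Suc j mod l)"
    if "inj_on f {0..<l}" "f ` {0..<l} \<subseteq> pverts G"
      "\<forall>i\<in>{0..<l}. \<forall>j\<in>{0..<l}. (f i, f j) \<in> parcs G \<longleftrightarrow> (i, j) \<in> parcs (cycle_graph l)" for f
    using that by (intro exI[of _ "map f [0..<l]"]) (auto simp: distinct_map **)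
  moreover have "\<exists>f. inj_on f {0..<l} \<and> f ` {0..<l} \<subseteq> pverts G \<and>
      (\<forall>i\<in>{0..<l}. \<forall>j\<in>{0..<l}. (f i, f j) \<in> parcs G \<longleftrightarrow> (i, j) \<in> parcs (cycle_graph l))"
    if "length xs = l" "distinct xs" "set xs \<subseteq> pverts G"
      "\<forall>i<l. \<forall>j<l. (xs ! i, xs ! j) \<in> parcs G \<longleftrightarrow> j = Suc i mod l \<or> i = Suc j mod l" for xs
    using that by (intro exI[of _ "(!) xs"]) (auto simp: ** intro!: inj_on_nth)
  ultimately show ?thesis
    unfolding free_of_iff_no_embedding[OF wf assms] * by blast
qed

text \<open>A cycle of length at least 4 has a chord \<open>a b\<close>, which cuts it into two shorter cycles. By
  induction both are cliques, and vertices \<open>y\<close>, \<open>z\<close> on different sides of the chord are adjacent,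
  since otherwise \<open>y, z, a, b\<close> would form a diamond.\<close>

lemma closed_chain_clique:
  assumes G: "pair_graph G" and diam: "free_of diamond G"
    and cyc: "\<And>l. 4 \<le> l \<Longrightarrow> l \<le> m \<Longrightarrow> free_of (cycle_graph l) G"
    and xs: "closed_chain (\<lambda>u v. (u, v) \<in> parcs G) xs" "distinct xs" "length xs \<le> m"
  shows "clique G (set xs)"
  using xs
proof (induction "length xs" arbitrary: xs rule: less_induct)
  case less
  interpret pair_graph G by fact
  let ?E = "\<lambda>u v. (u, v) \<in> parcs G"
  have step: "(xs ! i, xs ! (Suc i mod length xs)) \<in> parcs G" if "i < length xs" for i
    using less.prems(1) that by (simp add: closed_chain_conv_nth)
  have verts: "set xs \<subseteq> pverts G"
    using in_arcsD1[OF step] by (auto simp: in_set_conv_nth)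
  show ?case
  proof (cases "length xs \<le> 3")
    case True
    have "\<exists>a b c. xs = [a] \<or> xs = [a, b] \<or> xs = [a, b, c]"
      using True less.prems(1)
      by (cases xs; cases "tl xs"; cases "tl (tl xs)"; cases "tl (tl (tl xs))")
        (auto simp: closed_chain_def)
    then obtain a b c where "xs = [a] \<or> xs = [a, b] \<or> xs = [a, b, c]" by blast
    then show ?thesis
      using less.prems(1) verts by (auto simp: clique_def closed_chain_def intro: arcs_symmetric)
  next
    case False
    \<comment> \<open>Otherwise \<open>xs\<close> would induce a cycle of forbidden length. As all
      cyclic steps are edges, a failing pair \<open>i\<close>, \<open>j\<close> is a chord.\<close>
    then have "\<not> (\<forall>i<length xs. \<forall>j<length xs. (xs ! i, xs ! j) \<in> parcs G \<longleftrightarrow>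
        j = Suc i mod length xs \<or> i = Suc j mod length xs)"
      using cyc[of "length xs"] less.prems(2,3) verts
      unfolding free_of_cycle_graph_iff[OF pair_wf_digraph_axioms] by auto
    then obtain i j where ij: "i < length xs" "j < length xs" "(xs ! i, xs ! j) \<in> parcs G"
        "j \<noteq> Suc i mod length xs" "i \<noteq> Suc j mod length xs"
      using step arcs_symmetric by blast
    obtain i j where ij: "i < j" "j < length xs" "(xs ! i, xs ! j) \<in> parcs G"
        "j \<noteq> Suc i mod length xs" "i \<noteq> Suc j mod length xs"
    proof (cases i j rule: linorder_cases)
      case less
      then show thesis using ij that by blast
    next
      case equal
      then show thesis using ij(3) no_loops' by blast
    next
      case greater
      then show thesis using ij that[of j i] arcs_symmetric by blast
    qed
    \<comment> \<open>Rotation by \<open>i\<close> brings the end \<open>a\<close> of the chord to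
      the front and separates the two sides \<open>ys\<close> and \<open>zs\<close>.\<close>
    define a b where "a = xs ! i" and "b = xs ! j"
    define ys where "ys = take (j - Suc i) (drop (Suc i) xs)"
    define zs where "zs = drop (Suc j) xs @ take i xs"
    have "drop (Suc i) xs = ys @ b # drop (Suc j) xs"
      using id_take_nth_drop[of "j - Suc i" "drop (Suc i) xs"] ij(1,2)
      by (simp add: ys_def b_def)
    then have "xs = take i xs @ a # ys @ b # drop (Suc j) xs"
      using id_take_nth_drop[of i xs] ij(1,2) by (simp add: a_def)
    moreover have "length (take i xs) = i" using ij by simp
    ultimately have rot: "rotate i xs = a # ys @ b # zs"
      unfolding zs_def by (metis append.assoc append_Cons rotate_append)
    \<comment> \<open>Since \<open>i\<close> and \<open>j\<close> are not cyclically consecutive,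
      both sides are nonempty, which makes the two cycles through the chord strictly
      shorter.\<close>
    have "length ys = j - Suc i" "length zs = length xs - Suc j + i"
      using ij(1,2) by (simp_all add: ys_def zs_def)
    moreover have "j \<noteq> Suc i" using ij(2,4) by auto
    moreover have "\<not> (i = 0 \<and> Suc j = length xs)" using ij(5) by auto
    ultimately have len: "length ys > 0" "length zs > 0" using ij(1,2) by auto
    have "length xs = length (a # ys @ b # zs)"
      using arg_cong[OF rot, of length] by simp
    then have lens: "length (a # ys @ [b]) < length xs" "length (b # zs @ [a]) < length xs"
      using len by auto
    have chain: "closed_chain ?E (a # ys @ b # zs)" and dist: "distinct (a # ys @ b # zs)"
      using less.prems(1,2) unfolding rot[symmetric] closed_chain_rotate distinct_rotate .
    have ab: "(a, b) \<in> parcs G" "(b, a) \<in> parcs G"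
      using ij(3) by (auto simp: a_def b_def intro: arcs_symmetric)
    have "closed_chain ?E (a # ys @ [b])" "closed_chain ?E (b # zs @ [a])"
      using chain ab len by (auto simp: closed_chain_def successively_Cons successively_append_iff)
    then have cliques: "clique G (set (a # ys @ [b]))" "clique G (set (b # zs @ [a]))"
      using lens less.prems(3) dist by (intro less.hyps; auto)+
    have yz: "(y, z) \<in> parcs G" if "y \<in> set ys" "z \<in> set zs" for y z
    proof -
      have "(y, a) \<in> parcs G" "(y, b) \<in> parcs G" "(z, a) \<in> parcs G" "(z, b) \<in> parcs G" "y \<noteq> z"
        using that cliques dist by (auto simp: clique_def)
      then show ?thesis
        using diam ab(1) unfolding free_of_diamond_iff[OF G] by blast
    qed
    have "set xs = set (a # ys @ [b]) \<union> set (b # zs @ [a])"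
      using arg_cong[OF rot, of set] by auto
    then show ?thesis
      using cliques yz unfolding clique_def by (auto intro: arcs_symmetric)
  qed
qed

section \<open>Maximal cliques\<close>

lemma clique_subset_maximal_clique:
  assumes "finite (pverts G)" "clique G Q"
  obtains Q' where "Q' \<in> maximal_cliques G" "Q \<subseteq> Q'"
proof -
  have "finite {Q. clique G Q}"
    by (rule finite_subset[of _ "Pow (pverts G)"]) (use assms(1) in \<open>auto simp: clique_def\<close>)
  then obtain Q' where "clique G Q'" "Q \<subseteq> Q'" "\<forall>Q''. clique G Q'' \<longrightarrow> Q' \<subseteq> Q'' \<longrightarrow> Q' = Q''"
    using finite_has_maximal2[of "{Q. clique G Q}" Q] assms(2) by auto
  then show thesis by (intro that[of Q']) (auto simp: maximal_cliques_def)
qed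

text \<open>If \<open>x\<close> lies in \<open>P\<close> but not in \<open>P'\<close>, maximality of
  \<open>P'\<close> yields some \<open>y\<close> in \<open>P'\<close> not adjacent to
  \<open>x\<close>; then \<open>x\<close>, \<open>y\<close> and the common edge \<open>a b\<close>
  form a diamond.\<close>

lemma maximal_cliques_eqI:
  assumes G: "pair_graph G" and diam: "free_of diamond G"
    and Q: "Q \<in> maximal_cliques G" "Q' \<in> maximal_cliques G"
    and ab: "a \<noteq> b" "{a, b} \<subseteq> Q \<inter> Q'"
  shows "Q = Q'"
proof -
  interpret pair_graph G by fact
  have "P \<subseteq> P'" if P: "P \<in> maximal_cliques G" "P' \<in> maximal_cliques G" "{a, b} \<subseteq> P \<inter> P'" for P P'
  proof
    fix x assume x: "x \<in> P"
    show "x \<in> P'"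
    proof (rule ccontr)
      assume x': "x \<notin> P'"
      have cl: "clique G P" "clique G P'" using P by (auto simp: maximal_cliques_def)
      have "\<not> clique G (insert x P')"
        using P(2) x' by (auto simp: maximal_cliques_def)
      moreover have "clique G (insert x P')" if "\<forall>y\<in>P'. (x, y) \<in> parcs G"
        using that cl x by (auto simp: clique_def intro: arcs_symmetric)
      ultimately obtain y where y: "y \<in> P'" "(x, y) \<notin> parcs G" by blast
      have "(x, a) \<in> parcs G" "(x, b) \<in> parcs G" "(a, b) \<in> parcs G"
        using cl(1) x x' P(3) ab(1) by (auto simp: clique_def)
      moreover from this have "(y, a) \<in> parcs G" "(y, b) \<in> parcs G"
        using cl(2) y P(3) by (auto simp: clique_def)
      moreover have "x \<noteq> y" using y(1) x' by blast
      ultimately show False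
        using diam y(2) unfolding free_of_diamond_iff[OF G] by blast
    qed
  qed
  then show ?thesis using Q ab(2) by (intro equalityI) auto
qed

lemma vertex_clique_graph_eq:
  "vertex_clique_graph G = incidence_graph (pverts G) (maximal_cliques G)
     {(v, Q). Q \<in> maximal_cliques G \<and> v \<in> Q}"
proof -
  have "(\<Union>Q\<in>maximal_cliques G. \<Union>v\<in>Q. {(Inl v, Inr Q), (Inr Q, Inl v)}) =
    (\<Union>(v, Q)\<in>{(v, Q). Q \<in> maximal_cliques G \<and> v \<in> Q}. {(Inl v, Inr Q), (Inr Q, Inl v)})"
    by blast
  then show ?thesis unfolding vertex_clique_graph_def incidence_graph_def by simp
qed

text \<open>Every edge is a clique with two vertices and so lies in a maximal one. Read as
  incidences, this says that \<open>G\<close> is the half-square of its vertex-clique graph.\<close>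

lemma parcs_iff_maximal_clique:
  assumes "pair_graph G"
  shows "(u, v) \<in> parcs G \<longleftrightarrow> u \<noteq> v \<and> (\<exists>Q\<in>maximal_cliques G. u \<in> Q \<and> v \<in> Q)"
proof -
  interpret pair_graph G by fact
  have "\<exists>Q\<in>maximal_cliques G. u \<in> Q \<and> v \<in> Q" if "(u, v) \<in> parcs G"
  proof -
    have "clique G {u, v}"
      using that by (auto simp: clique_def intro: arcs_symmetric dest: in_arcsD1 in_arcsD2)
    then show ?thesis
      using clique_subset_maximal_clique[OF pair_finite_verts] by (metis insert_subset)
  qed
  then show ?thesis by (auto simp: maximal_cliques_def clique_def dest: no_loops')
qed

section \<open>From forbidden subgraphs to the girth of the vertex-clique graph\<close>

lemma girth_vertex_clique_graph_if_free:
  assumes G: "pair_graph G" and diam: "free_of diamond G"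
    and cyc: "\<And>l. 4 \<le> l \<Longrightarrow> l \<le> t - 1 \<Longrightarrow> free_of (cycle_graph l) G"
  shows "enat (2 * t) \<le> girth (vertex_clique_graph G)"
proof -
  interpret pair_graph G by fact
  let ?I = "{(v, Q). Q \<in> maximal_cliques G \<and> v \<in> Q}"
  have "t \<le> length ps" if ps: "incidence_cycle ?I ps" for ps
  proof (rule ccontr)
    assume short: "\<not> t \<le> length ps"
    let ?l = "length ps"
    have l: "2 \<le> ?l" and dist: "distinct (map fst ps)" "distinct (map snd ps)"
      using ps by (auto simp: incidence_cycle_def)
    define x where "x i = fst (ps ! i)" for i
    define Q where "Q i = snd (ps ! i)" for i
    have xQ: "Q i \<in> maximal_cliques G" "x i \<in> Q i" "x (Suc i mod ?l) \<in> Q i" if "i < ?l" for i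
      using incidence_cycle_nth[OF ps that] by (auto simp: x_def Q_def split_beta)
    have succ: "Suc i mod ?l < ?l" for i
      using l by (intro mod_less_divisor) linarith
    have neq: "x i \<noteq> x (Suc i mod ?l)" if i: "i < ?l" for i
    proof -
      have "i \<noteq> Suc i mod ?l" using i l by (auto simp: mod_Suc)
      then show ?thesis
        using nth_eq_iff_index_eq[OF dist(1), of i "Suc i mod ?l"] i succ[of i] by (simp add: x_def)
    qed
    \<comment> \<open>Consecutive vertices share the clique \<open>Q i\<close>, so a short incidence
      cycle projects to a short closed chain in \<open>G\<close>, to which
      \<open>closed_chain_clique\<close> applies.\<close>
    have "closed_chain (\<lambda>u v. (u, v) \<in> parcs G) (map fst ps)"
      unfolding closed_chain_conv_nth
    proof (intro conjI allI impI)
      show "map fst ps \<noteq> []" using l by auto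
      fix i assume "i < length (map fst ps)"
      then have i: "i < ?l" by simp
      then have "(x i, x (Suc i mod ?l)) \<in> parcs G"
        unfolding parcs_iff_maximal_clique[OF G] using neq[OF i] xQ[OF i] by blast
      then show "(map fst ps ! i, map fst ps ! (Suc i mod length (map fst ps))) \<in> parcs G"
        using i succ[of i] by (simp add: x_def)
    qed
    then have "clique G (set (map fst ps))"
      using dist(1) short by (intro closed_chain_clique[where m = "t - 1"] G diam cyc) auto
    then obtain R where R: "R \<in> maximal_cliques G" "set (map fst ps) \<subseteq> R"
      using clique_subset_maximal_clique[OF pair_finite_verts] by blast
    \<comment> \<open>\<open>Q i\<close> and \<open>R\<close> share two distinct vertices,
      \<open>x i\<close> and its cyclic successor, and hence coincide. With at least two entries
      this contradicts the distinctness of the \<open>Q i\<close>.\<close>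
    have "Q i = R" if i: "i < ?l" for i
    proof (rule maximal_cliques_eqI[OF G diam xQ(1)[OF i] R(1) neq[OF i]])
      have "x i \<in> R" "x (Suc i mod ?l) \<in> R" using R(2) i succ[of i] by (auto simp: x_def)
      then show "{x i, x (Suc i mod ?l)} \<subseteq> Q i \<inter> R" using xQ(2,3)[OF i] by blast
    qed
    moreover have "0 < ?l" "1 < ?l" using l by linarith+
    ultimately have "map snd ps ! 0 = map snd ps ! 1" by (simp add: Q_def)
    then show False
      using nth_eq_iff_index_eq[OF dist(2), of 0 1] \<open>0 < ?l\<close> \<open>1 < ?l\<close> by simp
  qed
  moreover have "?I \<subseteq> pverts G \<times> maximal_cliques G"
    by (auto simp: maximal_cliques_def clique_def)
  ultimately show ?thesis
    unfolding vertex_clique_graph_eq by (simp add: le_girth_incidence_graph_iff)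
qed

section \<open>From the vertex-clique graph to a half-square\<close>

lemma finite_maximal_cliques: "finite (pverts G) \<Longrightarrow> finite (maximal_cliques G)"
  by (rule finite_subset[of _ "Pow (pverts G)"]) (auto simp: maximal_cliques_def clique_def)

text \<open>Every edge of \<open>G\<close> becomes a path of length two through a common neighbour.
  As every element of \<open>W\<close> is incident with some vertex, each vertex of the incidence
  graph is linked to the \<open>Inl\<close> side.\<close>

lemma connected_incidence_graph:
  assumes G: "pair_wf_digraph G" "symmetric G" "connected G"
    and I: "I \<subseteq> pverts G \<times> W" "W \<subseteq> snd ` I"
    and adj: "\<And>u v. (u, v) \<in> parcs G \<Longrightarrow> \<exists>w. (u, w) \<in> I \<and> (v, w) \<in> I"
  shows "connected (incidence_graph (pverts G) W I)"
proof -
  let ?B = "incidence_graph (pverts G) W I"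
  have conn: "(u, v) \<in> (parcs G)\<^sup>*" if "u \<in> pverts G" "v \<in> pverts G" for u v
    using G that by (auto simp: connected_iff_rtrancl)
  have ne: "pverts G \<noteq> {}" using G by (simp add: connected_iff_rtrancl)
  have sym: "sym ((parcs ?B)\<^sup>*)"
    by (rule sym_rtrancl) (auto simp: sym_def parcs_incidence_graph_cases)
  have V: "(Inl u, Inl v) \<in> (parcs ?B)\<^sup>*" if "(u, v) \<in> (parcs G)\<^sup>*" for u v
    using that
  proof (induction rule: rtrancl_induct)
    case (step v v')
    obtain w where "(v, w) \<in> I" "(v', w) \<in> I" using adj[OF step(2)] by blast
    then have "(Inl v, Inr w) \<in> parcs ?B" "(Inr w, Inl v') \<in> parcs ?B" by auto
    then show ?case using step.IH by (meson rtrancl.rtrancl_into_rtrancl)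
  qed simp
  have to_V: "\<exists>v\<in>pverts G. (x, Inl v) \<in> (parcs ?B)\<^sup>*" if x: "x \<in> pverts ?B" for x
  proof (cases x)
    case (Inl v)
    then show ?thesis using x by auto
  next
    case (Inr w)
    then obtain v where v: "(v, w) \<in> I" using x I(2) by force
    then have "(x, Inl v) \<in> parcs ?B" using Inr by simp
    moreover have "v \<in> pverts G" using v I(1) by auto
    ultimately show ?thesis by blast
  qed
  have "symmetric ?B"
    by (auto simp: symmetric_def sym_def parcs_incidence_graph_cases)
  have "(x, y) \<in> (parcs ?B)\<^sup>*" if xy: "x \<in> pverts ?B" "y \<in> pverts ?B" for x y
  proof -
    obtain u v where uv: "u \<in> pverts G" "v \<in> pverts G"
      "(x, Inl u) \<in> (parcs ?B)\<^sup>*" "(y, Inl v) \<in> (parcs ?B)\<^sup>*"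
      using to_V xy by blast
    have "(Inl u, Inl v) \<in> (parcs ?B)\<^sup>*" using V conn uv(1,2) by blast
    moreover have "(Inl v, y) \<in> (parcs ?B)\<^sup>*" using sym uv(4) by (rule symD)
    ultimately show ?thesis using uv(3) by (meson rtrancl_trans)
  qed
  then show ?thesis
    unfolding connected_iff_rtrancl[OF pair_wf_digraph_incidence_graph[OF I(1)] \<open>symmetric ?B\<close>]
    using ne by auto
qed

text \<open>Renames the second class along \<open>g\<close>, in order to carry cycles over numeric
  labels back to cliques. Injectivity keeps the second components distinct.\<close>

lemma incidence_cycle_map:
  assumes ps: "incidence_cycle I ps" and map: "\<And>a b. (a, b) \<in> I \<Longrightarrow> (a, g b) \<in> J"
    and inj: "inj_on g (snd ` I)"
  shows "incidence_cycle J (map (apsnd g) ps)"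
proof (rule incidence_cycleI)
  fix i assume "i < length (map (apsnd g) ps)"
  then have i: "i < length ps" by simp
  then have "Suc i mod length ps < length ps" by (intro mod_less_divisor) linarith
  then show "(fst (map (apsnd g) ps ! (Suc i mod length (map (apsnd g) ps))),
      snd (map (apsnd g) ps ! i)) \<in> J"
    using map[OF incidence_cycle_nth(2)[OF ps i]] i by simp
  have "(fst (ps ! i), snd (ps ! i)) \<in> I" using incidence_cycle_nth(1)[OF ps i] by simp
  from map[OF this] show "map (apsnd g) ps ! i \<in> J" using i by (simp add: apsnd_def map_prod_def split_beta)
next
  have "set (map snd ps) \<subseteq> snd ` I"
    using incidence_cycle_nth(1)[OF ps] by (fastforce simp: in_set_conv_nth)
  then have "distinct (map g (map snd ps))"
    using ps inj_on_subset[OF inj] unfolding distinct_map[of g] by (simp add: incidence_cycle_def)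
  then show "distinct (map snd (map (apsnd g) ps))" by (simp add: comp_def)
  show "distinct (map fst (map (apsnd g) ps))" "2 \<le> length (map (apsnd g) ps)"
    using ps by (simp_all add: incidence_cycle_def comp_def)
qed

text \<open>Trades the bipartite graph for a relation \<open>I\<close>, so that girth turns into a
  bound on incidence cycles and the half-square into common neighbours.\<close>

lemma half_square_iff_incidence_graph:
  assumes G: "pair_graph G"
  shows "half_square_of_girth_ge (2 * t) G \<longleftrightarrow> (\<exists>(W :: nat set) I. finite W \<and> I \<subseteq> pverts G \<times> W \<and>
    connected (incidence_graph (pverts G) W I) \<and>
    (\<forall>ps. incidence_cycle I ps \<longrightarrow> t \<le> length ps) \<and>
    (\<forall>u v. (u, v) \<in> parcs G \<longleftrightarrow> u \<noteq> v \<and> (\<exists>w. (u, w) \<in> I \<and> (v, w) \<in> I)))"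
    (is "_ \<longleftrightarrow> (\<exists>W I. ?P W I)")
proof -
  interpret pair_graph G by fact
  have *: "with_proj (rename_graph Inl G) = half_square (incidence_graph (pverts G) W I) (Inl ` pverts G) \<longleftrightarrow>
    (\<forall>u v. (u, v) \<in> parcs G \<longleftrightarrow> u \<noteq> v \<and> (\<exists>w. (u, w) \<in> I \<and> (v, w) \<in> I))"
    if "I \<subseteq> pverts G \<times> W" "finite W" for W :: "nat set" and I
  proof -
    let ?f = "map_prod Inl Inl :: 'a \<times> 'a \<Rightarrow> ('a + nat) \<times> ('a + nat)"
    let ?A = "{(u, v). u \<noteq> v \<and> (\<exists>w. (u, w) \<in> I \<and> (v, w) \<in> I)}"
    have "{(Inl u, Inl v) |u v. u \<noteq> v \<and> (\<exists>w. (u, w) \<in> I \<and> (v, w) \<in> I)} = ?f ` ?A"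
      by (auto simp: map_prod_def)
    then have "with_proj (rename_graph Inl G) = half_square (incidence_graph (pverts G) W I) (Inl ` pverts G)
      \<longleftrightarrow> ?f ` parcs G = ?f ` ?A"
      unfolding half_square_incidence_graph[OF that(1) pair_finite_verts that(2)]
      by (simp add: with_proj_def rename_graph_def)
    also have "\<dots> \<longleftrightarrow> parcs G = ?A"
      by (intro inj_image_eq_iff prod.inj_map) auto
    also have "\<dots> \<longleftrightarrow> (\<forall>u v. (u, v) \<in> parcs G \<longleftrightarrow> u \<noteq> v \<and> (\<exists>w. (u, w) \<in> I \<and> (v, w) \<in> I))"
      by (simp add: set_eq_iff)
    finally show ?thesis .
  qed
  show ?thesis
  proof
    assume "half_square_of_girth_ge (2 * t) G"
    then obtain W :: "nat set" and B where
      B: "bipartite_graph (Inl ` pverts G) (Inr ` W) B" "connected B" "enat (2 * t) \<le> girth B"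
        "with_proj (rename_graph Inl G) = half_square B (Inl ` pverts G)"
      unfolding half_square_of_girth_ge_def by blast
    obtain I where I: "I \<subseteq> pverts G \<times> W" "B = incidence_graph (pverts G) W I"
      using bipartite_graph_eq_incidence_graph[OF B(1)] .
    interpret B: pair_graph B using B(1) by (simp add: bipartite_graph_def)
    have "finite (pverts B)" by (rule B.pair_finite_verts)
    then have W: "finite W" using I(2) by (auto dest: finite_imageD)
    have "?P W I"
      using B(2-4) W I(1) *[OF I(1) W] le_girth_incidence_graph_iff[OF I(1)] unfolding I(2) by blast
    then show "\<exists>W I. ?P W I" by blast
  next
    assume "\<exists>W I. ?P W I"
    then obtain W I where P: "?P W I" by blast
    then have I: "I \<subseteq> pverts G \<times> W" "finite W" by auto
    show "half_square_of_girth_ge (2 * t) G"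
      unfolding half_square_of_girth_ge_def
    proof (intro exI conjI)
      show "bipartite_graph (Inl ` pverts G) (Inr ` W) (incidence_graph (pverts G) W I)"
        using I pair_finite_verts by (intro bipartite_graph_incidence_graph)
      show "connected (incidence_graph (pverts G) W I)" using P by blast
      show "enat (2 * t) \<le> girth (incidence_graph (pverts G) W I)"
        using P le_girth_incidence_graph_iff[OF I(1)] by blast
      show "with_proj (rename_graph Inl G) = half_square (incidence_graph (pverts G) W I) (Inl ` pverts G)"
        using P *[OF I] by blast
    qed
  qed
qed

text \<open>The definition asks for a second class of natural numbers, so the finitely many maximal
  cliques are numbered by an injection \<open>f\<close>.\<close>

lemma half_square_if_girth_vertex_clique_graph:
  assumes G: "pair_graph G" "connected G" and girth: "enat (2 * t) \<le> girth (vertex_clique_graph G)"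
  shows "half_square_of_girth_ge (2 * t) G"
proof -
  interpret pair_graph G by fact
  let ?M = "maximal_cliques G"
  have fin: "finite ?M" by (intro finite_maximal_cliques pair_finite_verts)
  then obtain f :: "'a set \<Rightarrow> nat" where f: "inj_on f ?M"
    using finite_imp_inj_to_nat_seg by blast
  define I where "I = {(v, f Q) |v Q. Q \<in> ?M \<and> v \<in> Q}"
  have sub: "?M \<subseteq> Pow (pverts G)" by (auto simp: maximal_cliques_def clique_def)
  have I_sub: "I \<subseteq> pverts G \<times> f ` ?M" using sub by (auto simp: I_def)
  have adj: "(u, v) \<in> parcs G \<longleftrightarrow> u \<noteq> v \<and> (\<exists>w. (u, w) \<in> I \<and> (v, w) \<in> I)" for u v
  proof -
    have "(\<exists>w. (u, w) \<in> I \<and> (v, w) \<in> I) \<longleftrightarrow> (\<exists>Q\<in>?M. u \<in> Q \<and> v \<in> Q)"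
      using f by (auto simp: I_def dest: inj_onD)
    then show ?thesis using parcs_iff_maximal_clique[OF G(1)] by simp
  qed
  \<comment> \<open>A connected graph has a vertex \<open>v\<close>, and the clique
    \<open>{v}\<close> shows that the empty set is not maximal. Hence every label is incident with
    some vertex, as \<open>connected_incidence_graph\<close> demands.\<close>
  have ne: "Q \<noteq> {}" if "Q \<in> ?M" for Q
  proof
    assume "Q = {}"
    moreover obtain v where "v \<in> pverts G"
      using G(2) by (auto simp: connected_iff_rtrancl[OF pair_wf_digraph_axioms pair_sym_arcs])
    then have "clique G {v}" by (simp add: clique_def)
    ultimately show False using that by (auto simp: maximal_cliques_def)
  qed
  have "f ` ?M \<subseteq> snd ` I"
  proof
    fix w assume "w \<in> f ` ?M"
    then obtain Q v where "Q \<in> ?M" "w = f Q" "v \<in> Q" using ne by blast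
    then have "(v, w) \<in> I" by (auto simp: I_def)
    then show "w \<in> snd ` I" by force
  qed
  then have "connected (incidence_graph (pverts G) (f ` ?M) I)"
    using I_sub adj by (intro connected_incidence_graph G(2) pair_sym_arcs pair_wf_digraph_axioms) auto
  moreover have "t \<le> length ps" if ps: "incidence_cycle I ps" for ps
  proof -
    \<comment> \<open>The inverse of \<open>f\<close> turns a cycle over labels into one of the
      vertex-clique graph, where the girth bound applies.\<close>
    let ?J = "{(v, Q). Q \<in> ?M \<and> v \<in> Q}"
    have "incidence_cycle ?J (map (apsnd (inv_into ?M f)) ps)"
      using ps
    proof (rule incidence_cycle_map)
      show "(a, inv_into ?M f b) \<in> ?J" if "(a, b) \<in> I" for a b
        using that f by (auto simp: I_def)
      show "inj_on (inv_into ?M f) (snd ` I)"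
        by (rule inj_on_subset[OF inj_on_inv_into[OF order_refl]]) (use I_sub in auto)
    qed
    moreover have "?J \<subseteq> pverts G \<times> ?M" using sub by auto
    ultimately show ?thesis
      using girth unfolding vertex_clique_graph_eq by (auto simp: le_girth_incidence_graph_iff)
  qed
  ultimately show ?thesis
    unfolding half_square_iff_incidence_graph[OF G(1)] using fin I_sub adj
    by (intro exI[of _ "f ` ?M"] exI[of _ I]) auto
qed

section \<open>From a half-square to forbidden subgraphs\<close>

text \<open>As \<open>t\<close> is at least 4, incidence cycles with two or three pairs are
  excluded. The former makes the common neighbour of two vertices unique, the latter gives the three
  vertices of a triangle a common neighbour.\<close>

lemma free_if_incidence_girth:
  assumes G: "pair_graph G"
    and adj: "\<And>u v. (u, v) \<in> parcs G \<longleftrightarrow> u \<noteq> v \<and> (\<exists>w. (u, w) \<in> I \<and> (v, w) \<in> I)"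
    and girth: "\<And>ps. incidence_cycle I ps \<Longrightarrow> t \<le> length ps"
    and t: "4 \<le> t"
  shows "free_of diamond G" "4 \<le> l \<Longrightarrow> l < t \<Longrightarrow> free_of (cycle_graph l) G"
proof -
  interpret pair_graph G by fact
  have two: "w = w'" if "u \<noteq> v" "(u, w) \<in> I" "(v, w) \<in> I" "(u, w') \<in> I" "(v, w') \<in> I" for u v w w'
  proof (rule ccontr)
    assume "w \<noteq> w'"
    then have "incidence_cycle I [(u, w), (v, w')]"
      using that by (simp add: incidence_cycle_def closed_chain_def)
    then show False using girth t by fastforce
  qed
  have triangle: "\<exists>w. (a, w) \<in> I \<and> (b, w) \<in> I \<and> (c, w) \<in> I"
    if abc: "(a, b) \<in> parcs G" "(b, c) \<in> parcs G" "(c, a) \<in> parcs G" for a b c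
  proof (rule ccontr)
    assume no: "\<not> ?thesis"
    obtain x y z where w: "(a, x) \<in> I" "(b, x) \<in> I" "(b, y) \<in> I" "(c, y) \<in> I" "(c, z) \<in> I" "(a, z) \<in> I"
      using abc by (metis adj)
    have "a \<noteq> b" "b \<noteq> c" "c \<noteq> a" using abc by (simp_all add: adj)
    moreover have "x \<noteq> y" "y \<noteq> z" "x \<noteq> z" using no w by blast+
    ultimately have "incidence_cycle I [(a, x), (b, y), (c, z)]"
      using w by (simp add: incidence_cycle_def closed_chain_def)
    then show False using girth t by fastforce
  qed
  show "free_of diamond G"
    unfolding free_of_diamond_iff[OF G]
  proof (rule notI, elim exE conjE)
    fix a b c d
    assume h: "a \<noteq> b" "(a, b) \<notin> parcs G" "(c, d) \<in> parcs G" "(a, c) \<in> parcs G" "(a, d) \<in> parcs G"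
      "(b, c) \<in> parcs G" "(b, d) \<in> parcs G"
    obtain w where w: "(a, w) \<in> I" "(c, w) \<in> I" "(d, w) \<in> I"
      using triangle[of a c d] h arcs_symmetric by blast
    obtain w' where w': "(b, w') \<in> I" "(c, w') \<in> I" "(d, w') \<in> I"
      using triangle[of b c d] h arcs_symmetric by blast
    \<comment> \<open>The two triangles share the edge \<open>c d\<close>, whose common neighbour is
      unique; so \<open>a\<close> and \<open>b\<close> meet in it as well and would be
      adjacent.\<close>
    have "w = w'" using two[of c d] w w' h(3) by (auto simp: adj)
    then show False using h(1,2) w(1) w'(1) by (auto simp: adj)
  qed
  show "free_of (cycle_graph l) G" if l: "4 \<le> l" "l < t"
    unfolding free_of_cycle_graph_iff[OF pair_wf_digraph_axioms]
  proof (rule notI, elim exE conjE)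
    fix xs assume xs: "length xs = l" "distinct xs"
      "\<forall>i<l. \<forall>j<l. (xs ! i, xs ! j) \<in> parcs G \<longleftrightarrow> j = Suc i mod l \<or> i = Suc j mod l"
    have succ: "Suc i mod l < l" for i using l(1) by (intro mod_less_divisor) linarith
    have "\<exists>w. (xs ! i, w) \<in> I \<and> (xs ! (Suc i mod l), w) \<in> I" if "i < l" for i
    proof -
      have "(xs ! i, xs ! (Suc i mod l)) \<in> parcs G" using xs(3) that succ[of i] by blast
      then show ?thesis by (simp add: adj)
    qed
    \<comment> \<open>\<open>w i\<close> is a common neighbour chosen for the \<open>i\<close>-th
      edge of the cycle; the pairs \<open>(xs ! i, w i)\<close> are to form an incidence cycle of
      length \<open>l\<close>, which is below \<open>t\<close>.\<close>
    then obtain w where w: "\<And>i. i < l \<Longrightarrow> (xs ! i, w i) \<in> I \<and> (xs ! (Suc i mod l), w i) \<in> I"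
      by metis
    \<comment> \<open>Distinct vertices with a common neighbour are adjacent, which in an induced
      cycle happens only between cyclic neighbours.\<close>
    have near: "i = j \<or> j = Suc i mod l \<or> i = Suc j mod l"
      if "i < l" "j < l" "(xs ! i, v) \<in> I" "(xs ! j, v) \<in> I" for i j v
      using that xs nth_eq_iff_index_eq[OF xs(2), of i j] adj by blast
    \<comment> \<open>If two consecutive edges shared \<open>w i\<close>, the positions
      \<open>i\<close> and \<open>i + 2\<close> would be equal or cyclic neighbours, which fails for
      \<open>l \<ge> 4\<close>.\<close>
    have next_neq: "w i \<noteq> w (Suc i mod l)" if i: "i < l" for i
    proof
      assume eq: "w i = w (Suc i mod l)"
      let ?j = "Suc (Suc i mod l) mod l"
      have "i = ?j \<or> ?j = Suc i mod l \<or> i = Suc ?j mod l"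
        using near[OF i succ[of "Suc i mod l"]] w[OF i] w[OF succ[of i]] eq by metis
      then show False using i l(1) by (auto simp: mod_Suc split: if_splits)
    qed
    \<comment> \<open>Distinct positions with equal \<open>w\<close> are cyclic neighbours by
      \<open>near\<close>, and \<open>next_neq\<close> rules this out.\<close>
    have "inj_on w {0..<l}"
    proof (rule inj_onI, rule ccontr)
      fix i j assume ij: "i \<in> {0..<l}" "j \<in> {0..<l}" "w i = w j" "i \<noteq> j"
      then have "j = Suc i mod l \<or> i = Suc j mod l"
        using near[of i j "w i"] w[of i] w[of j] by auto
      then show False using next_neq[of i] next_neq[of j] ij by auto
    qed
    moreover have "map fst (map (\<lambda>i. (xs ! i, w i)) [0..<l]) = xs"
      using map_nth[of xs] xs(1) by (simp add: comp_def)
    ultimately have "incidence_cycle I (map (\<lambda>i. (xs ! i, w i)) [0..<l])"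
      using w xs(2) succ l(1) by (intro incidence_cycleI) (auto simp: distinct_map comp_def)
    then show False using girth l(2) by fastforce
  qed
qed

theorem theorem2:
  fixes G :: "'a pair_pre_digraph" and t :: nat
  assumes "4 \<le> t" and "pair_graph G" and "connected G"
  shows "(half_square_of_girth_ge (2 * t) G \<longleftrightarrow>
            free_of diamond G \<and> (\<forall>l. 4 \<le> l \<and> l \<le> t - 1 \<longrightarrow> free_of (cycle_graph l) G)) \<and>
         (free_of diamond G \<and> (\<forall>l. 4 \<le> l \<and> l \<le> t - 1 \<longrightarrow> free_of (cycle_graph l) G) \<longleftrightarrow>
            enat (2 * t) \<le> girth (vertex_clique_graph G))"
    (is "(?half_square \<longleftrightarrow> ?free) \<and> (?free \<longleftrightarrow> ?girth)")
proof -
  have "?free" if half_square: "?half_square"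
  proof -
    obtain W :: "nat set" and I where
      "\<forall>ps. incidence_cycle I ps \<longrightarrow> t \<le> length ps"
      "\<forall>u v. (u, v) \<in> parcs G \<longleftrightarrow> u \<noteq> v \<and> (\<exists>w. (u, w) \<in> (I :: ('a \<times> nat) set) \<and> (v, w) \<in> I)"
      using half_square unfolding half_square_iff_incidence_graph[OF assms(2)] by blast
    with free_if_incidence_girth[OF assms(2), of I t] assms(1) show ?thesis by auto
  qed
  moreover have "?girth" if "?free"
    using that by (intro girth_vertex_clique_graph_if_free assms(2)) auto
  moreover have "?half_square" if "?girth"
    using assms(2,3) that by (rule half_square_if_girth_vertex_clique_graph)
  ultimately show ?thesis by blast
qed

end
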